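(* Let $m$ be a real number (mass parameter), let $r\in\{0,1,2,3\}$, and let $\overset{r}{\omega}\in K^r(4)$, $\overset{r+1}{\omega}\in K^{r+1}(4)$. If the inhomogeneous form $\overset{r}{\omega}+\overset{r+1}{\omega}$ is a solution of the discrete Duffin equation $$(d^c-\delta^c)\bigl(\overset{r}{\omega}+\overset{r+1}{\omega}\bigr)=m\bigl(\overset{r}{\omega}+\overset{r+1}{\omega}\bigr),$$ then the $r$-form $\overset{r}{\omega}$ satisfies the discrete Klein-Gordon equation $$\Delta^c\overset{r}{\omega}=m^2\overset{r}{\omega}.$$
   Context: Chains. Let $C=C^0\oplus C^1$, where $C^0$ is the real vector space with basis $x_\kappa$ ($\kappa\in\mathbb Z$) and $C^1$ the real vector space with basis $e_\kappa$ ($\kappa\in\mathbb Z$); put $\tau\kappa=\kappa+1$, $\partial x_\kappa=0$, $\partial e_\kappa=x_{\tau\kappa}-x_\kappa$. Let $C(4)=C\otimes C\otimes C\otimes C$, with basis elements $s_k=s_{k_0}\otimes s_{k_1}\otimes s_{k_2}\otimes s_{k_3}$, $k=(k_0,k_1,k_2,k_3)\in\mathbb Z^4$, each $s_{k_i}$ being $x_{k_i}$ or $e_{k_i}$; the dimension of $s_k$ is the number of factors of type $e$. The boundary is extended by $\partial(a\otimes b)=\partial a\otimes b+(-1)^{\dim a}a\otimes\partial b$ and linearity. Cochains (discrete forms). $K(4)=K\otimes K\otimes K\otimes K$ is the dual complex of real cochains, with basis elements $s^k=s^{k_0}\otimes s^{k_1}\otimes s^{k_2}\otimes s^{k_3}$,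 each $s^{k_i}$ being $x^{k_i}$ or $e^{k_i}$. Forms are (possibly infinite) formal real linear combinations of basis elements. The pairing is $\langle \varepsilon_k,s^k\rangle=1$ if $\varepsilon_k=s_k$ is the corresponding basis chain and $0$ otherwise, extended linearly. $K^r(4)$ is the space of forms of degree $r$, $K(4)=\bigoplus_{r=0}^4K^r(4)$. The coboundary $d^c:K^r(4)\to K^{r+1}(4)$ is defined by $\langle\partial a,\omega\rangle=\langle a,d^c\omega\rangle$ for all $(r+1)$-chains $a$; $d^c\omega=0$ for $\omega\in K^4(4)$. Cup product. On $K$: $x^\kappa\cup x^\kappa=x^\kappa$, $e^\kappa\cup x^{\tau\kappa}=e^\kappa$, $x^\kappa\cup e^\kappa=e^\kappa$, and all other products of basis elements are $0$. Inductively, for basis elements $s_{(p)},s_{(q)}$ of the $n$-fold tensor product of $K$ (of degrees $p,q$) and basis elements $s^\kappa,s^\mu$ of $K$, $(s_{(p)}\otimes s^\kappa)\cup(s_{(q)}\otimes s^\mu)=Q(\kappa,q)\,(s_{(p)}\cup s_{(q)})\otimes(s^\kappa\cup s^\mu)$, where $Q(\kappa,q)=-1$ if both $s^\kappa$ and $s_{(q)}$ have odd degree and $Q(\kappa,q)=+1$ otherwise. Extend linearly. Star operator (Lorentz signature). $\ast:K^r(4)\to K^{4-r}(4)$ is the linear bijection sending a basis element $s^k$ to the unique element of the form $\pm$(basis element) with $s^k\cup\ast s^k=Q(k_0)e^k$, where $e^k=e^{k_0}\otimes e^{k_1}\otimes e^{k_2}\otimes e^{k_3}$, $Q(k_0)=+1$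 if $s^{k_0}=x^{k_0}$ and $Q(k_0)=-1$ if $s^{k_0}=e^{k_0}$ (so, up to sign, $\ast$ replaces each factor $x^{k_i}$ by $e^{k_i}$ and each factor $e^{k_i}$ by $x^{\tau k_i}$). Codifferential and Laplacian. $\delta^c:K^{r+1}(4)\to K^r(4)$, $\delta^c\psi=(-1)^{r+1}\ast^{-1}d^c\ast\psi$ for $\psi\in K^{r+1}(4)$, $r=0,1,2,3$; $\delta^c\omega=0$ for $\omega\in K^0(4)$. $\Delta^c=-(d^c\delta^c+\delta^cd^c)$. All operators act on inhomogeneous forms (sums of forms of different degrees) by linearity. *)

theory Defs
  imports Complex_Main "HOL-Library.Function_Algebras" "HOL-Library.Poly_Mapping"
begin

text \<open>
  The constructors \<open>X \<kappa>\<close>, \<open>E \<kappa>\<close> index the basis elements of the one-dimensional complexes: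
  \<open>x\<^sub>\<kappa>\<close>, \<open>e\<^sub>\<kappa>\<close> of \<open>C\<close> as well as \<open>x\<^sup>\<kappa>\<close>, \<open>e\<^sup>\<kappa>\<close> of \<open>K\<close>.  Tensor powers are nested to the left,
  so the basis element \<open>s\<^sub>0 \<otimes> s\<^sub>1 \<otimes> s\<^sub>2 \<otimes> s\<^sub>3\<close> is indexed by \<open>(((s\<^sub>0, s\<^sub>1), s\<^sub>2), s\<^sub>3)\<close>.
\<close>

datatype cell = X int | E int

type_synonym cell2 = "cell \<times> cell"
type_synonym cell3 = "cell2 \<times> cell"
type_synonym cell4 = "cell3 \<times> cell"

text \<open>
  A chain is a finite linear combination of basis elements \<open>'b\<close>, a form is a possibly infinite
  formal one, i.e. an arbitrary coefficient function.  Addition, subtraction and \<open>0\<close> of forms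
  are the pointwise operations of \<^theory>\<open>HOL-Library.Function_Algebras\<close>.
\<close>

type_synonym 'b chain = "'b \<Rightarrow>\<^sub>0 real"
type_synonym 'b form = "'b \<Rightarrow> real"

definition scale :: "real \<Rightarrow> 'b form \<Rightarrow> 'b form" (infixr \<open>*\<^sub>f\<close> 75)
  where "c *\<^sub>f \<omega> = (\<lambda>s. c * \<omega> s)"

definition basis_form :: "'b \<Rightarrow> 'b form"
  where "basis_form s = (\<lambda>t. if t = s then 1 else 0)"

definition scale_chain :: "real \<Rightarrow> 'b chain \<Rightarrow> 'b chain" (infixr \<open>*\<^sub>c\<close> 75)
  where "c *\<^sub>c a = Poly_Mapping.map ((*) c) a"

definition basis_chain :: "'b \<Rightarrow> 'b chain"
  where "basis_chain s = Poly_Mapping.single s 1"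


subsection \<open>Degrees\<close>

fun dim1 :: "cell \<Rightarrow> nat" where
  "dim1 (X \<kappa>) = 0"
| "dim1 (E \<kappa>) = 1"

fun dim_tensor :: "('b \<Rightarrow> nat) \<Rightarrow> 'b \<times> cell \<Rightarrow> nat"
  where "dim_tensor dim_n (p, s) = dim_n p + dim1 s"

definition dim2 :: "cell2 \<Rightarrow> nat" where "dim2 = dim_tensor dim1"
definition dim3 :: "cell3 \<Rightarrow> nat" where "dim3 = dim_tensor dim2"
definition dim4 :: "cell4 \<Rightarrow> nat" where "dim4 = dim_tensor dim3"

definition chains :: "nat \<Rightarrow> cell4 chain set"
  where "chains r = {a. \<forall>s \<in> Poly_Mapping.keys a. dim4 s = r}"

definition forms :: "nat \<Rightarrow> cell4 form set"
  where "forms r = {\<omega>. \<forall>s. \<omega> s \<noteq> 0 \<longrightarrow> dim4 s = r}"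

definition component :: "nat \<Rightarrow> cell4 form \<Rightarrow> cell4 form"
  where "component r \<omega> = (\<lambda>s. if dim4 s = r then \<omega> s else 0)"


subsection \<open>Boundary\<close>

definition tensor_chain :: "'b chain \<Rightarrow> 'c chain \<Rightarrow> ('b \<times> 'c) chain" where
  "tensor_chain a b =
     (\<Sum>s \<in> Poly_Mapping.keys a. \<Sum>t \<in> Poly_Mapping.keys b.
        (Poly_Mapping.lookup a s * Poly_Mapping.lookup b t) *\<^sub>c basis_chain (s, t))"

fun bd1 :: "cell \<Rightarrow> cell chain" where
  "bd1 (X \<kappa>) = 0"
| "bd1 (E \<kappa>) = basis_chain (X (\<kappa> + 1)) - basis_chain (X \<kappa>)"

fun bd_tensor :: "('b \<Rightarrow> nat) \<Rightarrow> ('b \<Rightarrow> 'b chain) \<Rightarrow> 'b \<times> cell \<Rightarrow> ('b \<times> cell) chain" where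
  "bd_tensor dim_n bd_n (p, s) =
     tensor_chain (bd_n p) (basis_chain s)
     + (-1) ^ dim_n p *\<^sub>c tensor_chain (basis_chain p) (bd1 s)"

definition bd2 :: "cell2 \<Rightarrow> cell2 chain" where "bd2 = bd_tensor dim1 bd1"
definition bd3 :: "cell3 \<Rightarrow> cell3 chain" where "bd3 = bd_tensor dim2 bd2"
definition bd4 :: "cell4 \<Rightarrow> cell4 chain" where "bd4 = bd_tensor dim3 bd3"

definition boundary :: "cell4 chain \<Rightarrow> cell4 chain" where
  "boundary a = (\<Sum>s \<in> Poly_Mapping.keys a. Poly_Mapping.lookup a s *\<^sub>c bd4 s)"


subsection \<open>Pairing and coboundary\<close>

definition pairing :: "cell4 chain \<Rightarrow> cell4 form \<Rightarrow> real" where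
  "pairing a \<omega> = (\<Sum>s \<in> Poly_Mapping.keys a. Poly_Mapping.lookup a s * \<omega> s)"

definition coboundary_hom :: "nat \<Rightarrow> cell4 form \<Rightarrow> cell4 form" where
  "coboundary_hom r \<omega> =
     (if r < 4
      then THE \<eta>. \<eta> \<in> forms (r + 1) \<and>
             (\<forall>a \<in> chains (r + 1). pairing (boundary a) \<omega> = pairing a \<eta>)
      else 0)"

definition coboundary :: "cell4 form \<Rightarrow> cell4 form" (\<open>d\<^sup>c\<close>)
  where "d\<^sup>c \<omega> = (\<Sum>r\<le>4. coboundary_hom r (component r \<omega>))"


subsection \<open>Cup product\<close>

definition tensor_form :: "'b form \<Rightarrow> 'c form \<Rightarrow> ('b \<times> 'c) form"
  where "tensor_form \<omega> \<eta> = (\<lambda>(s, t). \<omega> s * \<eta> t)"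

fun cup1 :: "cell \<Rightarrow> cell \<Rightarrow> cell form" where
  "cup1 (X \<kappa>) (X \<mu>) = (if \<mu> = \<kappa> then basis_form (X \<kappa>) else 0)"
| "cup1 (E \<kappa>) (X \<mu>) = (if \<mu> = \<kappa> + 1 then basis_form (E \<kappa>) else 0)"
| "cup1 (X \<kappa>) (E \<mu>) = (if \<mu> = \<kappa> then basis_form (E \<kappa>) else 0)"
| "cup1 (E \<kappa>) (E \<mu>) = 0"

fun cup_tensor ::
  "('b \<Rightarrow> nat) \<Rightarrow> ('b \<Rightarrow> 'b \<Rightarrow> 'b form) \<Rightarrow> 'b \<times> cell \<Rightarrow> 'b \<times> cell \<Rightarrow> ('b \<times> cell) form" where
  "cup_tensor dim_n cup_n (p, s) (q, t) =
     (if odd (dim1 s) \<and> odd (dim_n q) then -1 else 1) *\<^sub>f tensor_form (cup_n p q) (cup1 s t)"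

definition cup2 :: "cell2 \<Rightarrow> cell2 \<Rightarrow> cell2 form" where "cup2 = cup_tensor dim1 cup1"
definition cup3 :: "cell3 \<Rightarrow> cell3 \<Rightarrow> cell3 form" where "cup3 = cup_tensor dim2 cup2"
definition cup4 :: "cell4 \<Rightarrow> cell4 \<Rightarrow> cell4 form" where "cup4 = cup_tensor dim3 cup3"

text \<open>
  Bilinear extension to infinite formal combinations: a given basis element occurs in only
  finitely many products of two basis elements (at most \<open>2\<^sup>4\<close>), so the sum below is finite.
\<close>

definition cup :: "cell4 form \<Rightarrow> cell4 form \<Rightarrow> cell4 form" (infixl \<open>\<smile>\<close> 70) where
  "\<omega> \<smile> \<eta> = (\<lambda>u. \<Sum>(s, t) \<in> {(s, t). cup4 s t u \<noteq> 0}. \<omega> s * \<eta> t * cup4 s t u)"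


subsection \<open>Star operator\<close>

fun raise1 :: "cell \<Rightarrow> cell" where
  "raise1 (X \<kappa>) = E \<kappa>"
| "raise1 (E \<kappa>) = E \<kappa>"

text \<open>For a basis element with multi-index \<open>k\<close>, this is the index of \<open>e\<^sup>k\<close>.\<close>

fun top_cell :: "cell4 \<Rightarrow> cell4" where
  "top_cell (((s0, s1), s2), s3) = (((raise1 s0, raise1 s1), raise1 s2), raise1 s3)"

fun lorentz_sign :: "cell4 \<Rightarrow> real" where
  "lorentz_sign (((X \<kappa>, s1), s2), s3) = 1"
| "lorentz_sign (((E \<kappa>, s1), s2), s3) = -1"

definition star_basis :: "cell4 \<Rightarrow> cell4 form" where
  "star_basis s =
     (THE \<eta>. (\<exists>c \<in> {1, -1}. \<exists>t. \<eta> = c *\<^sub>f basis_form t) \<and>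
        basis_form s \<smile> \<eta> = lorentz_sign s *\<^sub>f basis_form (top_cell s))"

text \<open>
  Linear extension to infinite combinations; each basis element occurs in \<open>\<pm>\<close> the star of
  exactly one basis element.  The resulting map is a bijection, so \<open>inv star\<close> is its inverse.
\<close>

definition star :: "cell4 form \<Rightarrow> cell4 form" where
  "star \<omega> = (\<lambda>u. \<Sum>s \<in> {s. star_basis s u \<noteq> 0}. \<omega> s * star_basis s u)"


subsection \<open>Codifferential and Laplacian\<close>

text \<open>\<open>codiff_hom p\<close> is the codifferential on forms of degree \<open>p\<close>, mapping them to degree \<open>p - 1\<close>.\<close>

definition codiff_hom :: "nat \<Rightarrow> cell4 form \<Rightarrow> cell4 form" where
  "codiff_hom p \<psi> = (if p = 0 then 0 else (-1) ^ p *\<^sub>f inv star (d\<^sup>c (star \<psi>)))"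

definition codiff :: "cell4 form \<Rightarrow> cell4 form" (\<open>\<delta>\<^sup>c\<close>)
  where "\<delta>\<^sup>c \<psi> = (\<Sum>p\<le>4. codiff_hom p (component p \<psi>))"

definition laplacian :: "cell4 form \<Rightarrow> cell4 form" (\<open>\<Delta>\<^sup>c\<close>)
  where "\<Delta>\<^sup>c \<omega> = - (d\<^sup>c (\<delta>\<^sup>c \<omega>) + \<delta>\<^sup>c (d\<^sup>c \<omega>))"

end

(*
  Splitting the Duffin equation by degree gives  d w_r = m w_s,  delta w_s = - m w_r  and
  delta w_r = 0, hence  Laplace w_r = - delta (d w_r) = - m delta w_s = m^2 w_r.  Only the
  linearity and the degrees of d and delta enter.
*)
theory Submission
  imports Defs
begin

section \<open>Forms\<close>

lemma sum_form_apply: "(\<Sum>i\<in>A. f i) x = (\<Sum>i\<in>A. f i x :: real)"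
  by (induction A rule: infinite_finite_induct) auto

lemma scale_apply [simp]: "(c *\<^sub>f \<omega>) s = c * \<omega> s"
  by (simp add: scale_def)

lemma scale_0_left [simp]: "0 *\<^sub>f \<omega> = 0"
  by (rule ext) simp

lemma scale_0_right [simp]: "c *\<^sub>f 0 = 0"
  by (rule ext) simp

lemma formsI: "(\<And>s. \<omega> s \<noteq> 0 \<Longrightarrow> dim4 s = r) \<Longrightarrow> \<omega> \<in> forms r"
  by (simp add: forms_def)

lemma forms_eq_0: "\<omega> \<in> forms r \<Longrightarrow> dim4 s \<noteq> r \<Longrightarrow> \<omega> s = 0"
  unfolding forms_def by blast

lemma component_apply: "component r \<omega> s = (if dim4 s = r then \<omega> s else 0)"
  by (simp add: component_def)

lemma component_add: "component r (\<omega> + \<eta>) = component r \<omega> + component r \<eta>"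
  by (auto simp: component_def)

lemma component_scale: "component r (c *\<^sub>f \<omega>) = c *\<^sub>f component r \<omega>"
  by (auto simp: component_def)

lemma component_in_forms: "\<omega> \<in> forms r \<Longrightarrow> component p \<omega> = (if p = r then \<omega> else 0)"
  by (rule ext) (auto simp: component_apply dest: forms_eq_0)

lemma dim1_le: "dim1 s \<le> 1"
  by (cases s) auto

lemma dim4_eq: "dim4 (((s0, s1), s2), s3) = dim1 s0 + dim1 s1 + dim1 s2 + dim1 s3"
  by (simp add: dim4_def dim3_def dim2_def)

lemma dim4_le: "dim4 s \<le> 4"
proof -
  obtain s0 s1 s2 s3 where "s = (((s0, s1), s2), s3)"
    by (metis prod.exhaust)
  then show ?thesis
    using dim1_le[of s0] dim1_le[of s1] dim1_le[of s2] dim1_le[of s3] by (simp add: dim4_eq)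
qed


section \<open>Pairing and coboundary\<close>

text \<open>Cells outside the support have coefficient 0, so pairings of several chains can be
  compared over one common finite index set.\<close>

lemma pairing_superset:
  assumes "finite A" "Poly_Mapping.keys a \<subseteq> A"
  shows "pairing a \<omega> = (\<Sum>s\<in>A. Poly_Mapping.lookup a s * \<omega> s)"
  unfolding pairing_def using assms
  by (intro sum.mono_neutral_left) (auto simp: in_keys_iff)

lemma pairing_0 [simp]: "pairing 0 \<omega> = 0"
  by (simp add: pairing_def)

lemma pairing_add_chain: "pairing (a + b) \<omega> = pairing a \<omega> + pairing b \<omega>"
proof -
  let ?A = "Poly_Mapping.keys a \<union> Poly_Mapping.keys b"
  have "Poly_Mapping.keys (a + b) \<subseteq> ?A"
    by (rule Poly_Mapping.keys_add)
  then show ?thesis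
    by (simp add: pairing_superset[of ?A] lookup_add distrib_right sum.distrib)
qed

text \<open>\<open>Poly_Mapping.map\<close> applies its function only to nonzero coefficients;
  multiplication by \<open>c\<close> fixes 0, so the guard makes no difference.\<close>

lemma lookup_scale_chain [simp]:
  "Poly_Mapping.lookup (c *\<^sub>c a) s = c * Poly_Mapping.lookup a s"
  by (simp add: scale_chain_def Poly_Mapping.map.rep_eq when_def)

lemma pairing_scale_chain: "pairing (c *\<^sub>c a) \<omega> = c * pairing a \<omega>"
proof -
  have "Poly_Mapping.keys (c *\<^sub>c a) \<subseteq> Poly_Mapping.keys a"
    by (auto simp: in_keys_iff)
  then show ?thesis
    by (simp add: pairing_superset[of "Poly_Mapping.keys a"] sum_distrib_left mult.assoc)
qed

lemma pairing_sum_chain: "pairing (\<Sum>i\<in>A. f i) \<omega> = (\<Sum>i\<in>A. pairing (f i) \<omega>)"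
  by (induction A rule: infinite_finite_induct) (auto simp: pairing_add_chain)

lemma pairing_basis_chain: "pairing (basis_chain s) \<omega> = \<omega> s"
  by (simp add: pairing_def basis_chain_def)

lemma pairing_add_form: "pairing a (\<omega> + \<eta>) = pairing a \<omega> + pairing a \<eta>"
  by (simp add: pairing_def distrib_left sum.distrib)

lemma pairing_scale_form: "pairing a (c *\<^sub>f \<omega>) = c * pairing a \<omega>"
  by (simp add: pairing_def sum_distrib_left mult.left_commute)

lemma pairing_form_0 [simp]: "pairing a 0 = 0"
  by (simp add: pairing_def)

section \<open>The coboundary in coordinates\<close>

lemma pairing_boundary:
  "pairing (boundary a) \<omega> =
     (\<Sum>s\<in>Poly_Mapping.keys a. Poly_Mapping.lookup a s * pairing (bd4 s) \<omega>)"
  by (simp add: boundary_def pairing_sum_chain pairing_scale_chain)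

lemma pairing_boundary_basis_chain: "pairing (boundary (basis_chain s)) \<omega> = pairing (bd4 s) \<omega>"
  unfolding pairing_boundary by (simp add: basis_chain_def)

text \<open>Resolves the definite description. Linearity in the chain reduces the adjunction to
  basis chains: this gives existence, and testing against \<open>basis_chain s\<close> gives
  uniqueness.\<close>

lemma coboundary_hom_eq:
  assumes "r < 4"
  shows "coboundary_hom r \<omega> = (\<lambda>s. if dim4 s = r + 1 then pairing (bd4 s) \<omega> else 0)"
    (is "_ = ?\<eta>")
proof -
  have "(THE \<eta>. \<eta> \<in> forms (r + 1) \<and>
      (\<forall>a \<in> chains (r + 1). pairing (boundary a) \<omega> = pairing a \<eta>)) = ?\<eta>"
  proof (rule the_equality)
    \<comment> \<open>Both sides are sums over the support of \<open>a\<close>, where every cell has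
      degree \<open>r + 1\<close>, so the conditional in the candidate always takes its first
      branch.\<close>
    have "pairing (boundary a) \<omega> = pairing a ?\<eta>" if "a \<in> chains (r + 1)" for a
      unfolding pairing_boundary unfolding pairing_def[of a]
      using that by (intro sum.cong) (auto simp: chains_def)
    then show "?\<eta> \<in> forms (r + 1) \<and>
        (\<forall>a \<in> chains (r + 1). pairing (boundary a) \<omega> = pairing a ?\<eta>)"
      by (simp add: forms_def)
  next
    fix \<eta>
    assume \<eta>: "\<eta> \<in> forms (r + 1) \<and>
      (\<forall>a \<in> chains (r + 1). pairing (boundary a) \<omega> = pairing a \<eta>)"
    have "\<eta> s = pairing (bd4 s) \<omega>" if "dim4 s = r + 1" for s
    proof -
      have "basis_chain s \<in> chains (r + 1)"
        using that by (simp add: chains_def basis_chain_def)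
      then have "pairing (boundary (basis_chain s)) \<omega> = pairing (basis_chain s) \<eta>"
        using \<eta> by blast
      then show ?thesis
        by (simp add: pairing_boundary_basis_chain pairing_basis_chain)
    qed
    then show "\<eta> = ?\<eta>"
      using \<eta> forms_eq_0 by fastforce
  qed
  then show ?thesis
    using assms by (simp add: coboundary_hom_def)
qed

text \<open>At a given cell at most one degree contributes. Degree 0 is split off because
  \<open>dim4 s - 1\<close> would be truncated to 0 there.\<close>

lemma coboundary_apply:
  "d\<^sup>c \<omega> s = (if dim4 s = 0 then 0 else pairing (bd4 s) (component (dim4 s - 1) \<omega>))"
proof -
  have "d\<^sup>c \<omega> s = (\<Sum>r\<le>4. coboundary_hom r (component r \<omega>) s)"
    by (simp add: coboundary_def sum_form_apply)
  also have "\<dots> = (\<Sum>r\<le>4. if dim4 s \<noteq> 0 \<and> r = dim4 s - 1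
                  then pairing (bd4 s) (component (dim4 s - 1) \<omega>) else 0)"
  \<comment> \<open>The summand \<open>r = 4\<close> is 0 by definition, and it never equals
    \<open>dim4 s - 1\<close> for positive \<open>dim4 s\<close>, since \<open>dim4 s\<close> is at
    most 4.\<close>
  proof (rule sum.cong)
    fix r :: nat
    assume "r \<in> {..4}"
    then show "coboundary_hom r (component r \<omega>) s = (if dim4 s \<noteq> 0 \<and> r = dim4 s - 1
                  then pairing (bd4 s) (component (dim4 s - 1) \<omega>) else 0)"
      using dim4_le[of s]
      by (cases "r < 4") (simp_all only: coboundary_hom_eq, auto simp: coboundary_hom_def)
  qed simp
  also have "\<dots> = (if dim4 s = 0 then 0 else pairing (bd4 s) (component (dim4 s - 1) \<omega>))"
    using dim4_le[of s] by (cases "dim4 s = 0") auto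
  finally show ?thesis .
qed

lemma coboundary_add: "d\<^sup>c (\<omega> + \<eta>) = d\<^sup>c \<omega> + d\<^sup>c \<eta>"
  by (rule ext) (simp add: coboundary_apply component_add pairing_add_form)

lemma coboundary_scale: "d\<^sup>c (c *\<^sub>f \<omega>) = c *\<^sub>f d\<^sup>c \<omega>"
  by (rule ext) (simp add: coboundary_apply component_scale pairing_scale_form)

lemma coboundary_0 [simp]: "d\<^sup>c 0 = 0"
  using coboundary_scale[of 0 0] by simp

text \<open>This includes \<open>r = 4\<close>: there is no cell of degree 5, so membership in
  \<open>forms 5\<close> says that the coboundary vanishes.\<close>

lemma coboundary_in_forms: "\<omega> \<in> forms r \<Longrightarrow> d\<^sup>c \<omega> \<in> forms (r + 1)"
  by (rule formsI) (auto simp: coboundary_apply component_in_forms split: if_splits)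


section \<open>Star operator\<close>

text \<open>The shift comes from the cup product: \<open>X (\<kappa> + 1)\<close> is the only right
  factor with a nonzero product with \<open>E \<kappa>\<close>.\<close>

fun dual1 :: "cell \<Rightarrow> cell" where
  "dual1 (X \<kappa>) = E \<kappa>"
| "dual1 (E \<kappa>) = X (\<kappa> + 1)"

definition dual4 :: "cell4 \<Rightarrow> cell4"
  where "dual4 = map_prod (map_prod (map_prod dual1 dual1) dual1) dual1"

lemma bij_dual1: "bij dual1"
proof (rule bijI')
  show "dual1 s = dual1 t \<longleftrightarrow> s = t" for s t
    by (cases s; cases t) auto
  show "\<exists>s. t = dual1 s" for t
  proof (cases t)
    case (X \<kappa>)
    then have "t = dual1 (E (\<kappa> - 1))" by simp
    then show ?thesis ..
  next
    case (E \<kappa>)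
    then have "t = dual1 (X \<kappa>)" by simp
    then show ?thesis ..
  qed
qed

lemma bij_map_prod: "bij f \<Longrightarrow> bij g \<Longrightarrow> bij (map_prod f g)"
  by (simp add: bij_def prod.inj_map map_prod_surj)

lemma bij_dual4: "bij dual4"
  unfolding dual4_def by (intro bij_map_prod bij_dual1)

text \<open>Dualizing swaps the two types in each of the four factors. Stating it as a sum avoids
  truncated subtraction.\<close>

lemma dim4_dual4: "dim4 (dual4 s) + dim4 s = 4"
proof -
  have "dim1 (dual1 t) = 1 - dim1 t" for t
    by (cases t) auto
  moreover obtain s0 s1 s2 s3 where "s = (((s0, s1), s2), s3)"
    by (metis prod.exhaust)
  ultimately show ?thesis
    using dim1_le[of s0] dim1_le[of s1] dim1_le[of s2] dim1_le[of s3]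
    by (simp add: dual4_def dim4_eq)
qed

section \<open>Nondegeneracy of the cup product at the top cell\<close>

text \<open>
  \<open>D s\<close> is the only basis element whose product with \<open>s\<close> involves the top cell \<open>T s\<close>.
  The finiteness clause keeps \<^const>\<open>cup\<close> from being a sum over an infinite set, which is \<open>0\<close>.
\<close>

definition dual_pairing :: "('b \<Rightarrow> 'b \<Rightarrow> 'b form) \<Rightarrow> ('b \<Rightarrow> 'b) \<Rightarrow> ('b \<Rightarrow> 'b) \<Rightarrow> bool" where
  "dual_pairing prd D T \<longleftrightarrow>
     (\<forall>s. \<exists>c \<in> {1, -1}. prd s (D s) = c *\<^sub>f basis_form (T s)) \<and>
     (\<forall>s t. t \<noteq> D s \<longrightarrow> prd s t (T s) = 0) \<and>
     (\<forall>u. finite {(s, t). prd s t u \<noteq> 0})"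

lemma dual_pairing_cup1: "dual_pairing cup1 dual1 raise1"
  unfolding dual_pairing_def
proof (intro conjI allI impI)
  show "\<exists>c \<in> {1, -1}. cup1 s (dual1 s) = c *\<^sub>f basis_form (raise1 s)" for s
    by (cases s) (auto simp: scale_def)
  show "cup1 s t (raise1 s) = 0" if "t \<noteq> dual1 s" for s t
    using that by (cases s; cases t) (auto simp: basis_form_def)
  show "finite {(s, t). cup1 s t u \<noteq> 0}" for u
  proof (rule finite_subset)
    \<comment> \<open>A nonzero product landing on a cell of index k has factors of index k or k +
      1, and k + 1 occurs only on an \<open>X\<close>; three cells therefore suffice for either
      factor.\<close>
    let ?k = "case u of X \<kappa> \<Rightarrow> \<kappa> | E \<kappa> \<Rightarrow> \<kappa>"
    let ?A = "{X ?k, E ?k, X (?k + 1)}"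
    show "{(s, t). cup1 s t u \<noteq> 0} \<subseteq> ?A \<times> ?A"
    proof (rule subrelI)
      fix s t
      assume "(s, t) \<in> {(s, t). cup1 s t u \<noteq> 0}"
      then have "cup1 s t u \<noteq> 0" by simp
      then show "(s, t) \<in> ?A \<times> ?A"
        by (cases s; cases t) (auto simp: basis_form_def split: if_splits)
    qed
  qed simp
qed

text \<open>The property passes to one more tensor factor: the sign rule contributes only a unit,
  whatever \<open>dim_n\<close> is, and a wrong partner in either component makes the product vanish
  at the top cell.\<close>

lemma dual_pairing_cup_tensor:
  assumes "dual_pairing prd D T"
  shows "dual_pairing (cup_tensor dim_n prd) (map_prod D dual1) (map_prod T raise1)"
  unfolding dual_pairing_def
proof (intro conjI allI impI)
  fix s :: "'a \<times> cell"
  obtain p q where s: "s = (p, q)" by force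
  obtain c where c: "c \<in> {1, -1}" "prd p (D p) = c *\<^sub>f basis_form (T p)"
    using assms unfolding dual_pairing_def by blast
  obtain c' where c': "c' \<in> {1, -1}" "cup1 q (dual1 q) = c' *\<^sub>f basis_form (raise1 q)"
    using dual_pairing_cup1 unfolding dual_pairing_def by blast
  let ?e = "if odd (dim1 q) \<and> odd (dim_n (D p)) then -1 else 1 :: real"
  have "cup_tensor dim_n prd s (map_prod D dual1 s)
      = (?e * c * c') *\<^sub>f basis_form (map_prod T raise1 s)"
    by (rule ext) (auto simp: s c c' tensor_form_def basis_form_def split: if_splits)
  moreover have "?e * c * c' \<in> {1, -1}"
    using c(1) c'(1) by auto
  ultimately show "\<exists>c \<in> {1, -1}. cup_tensor dim_n prd s (map_prod D dual1 s)
      = c *\<^sub>f basis_form (map_prod T raise1 s)"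
    by blast
next
  fix s t
  assume "t \<noteq> map_prod D dual1 s"
  moreover obtain p q p' q' where st: "s = (p, q)" "t = (p', q')" by force
  ultimately have "p' \<noteq> D p \<or> q' \<noteq> dual1 q" by auto
  then have "prd p p' (T p) = 0 \<or> cup1 q q' (raise1 q) = 0"
    using assms dual_pairing_cup1 unfolding dual_pairing_def by blast
  then show "cup_tensor dim_n prd s t (map_prod T raise1 s) = 0"
    by (auto simp: st tensor_form_def)
next
  fix u :: "'a \<times> cell"
  obtain v w where u: "u = (v, w)" by force
  let ?A = "{(s, t). prd s t v \<noteq> 0}" and ?B = "{(s, t). cup1 s t w \<noteq> 0}"
  have "finite (?A \<times> ?B)"
    using assms dual_pairing_cup1 by (simp add: dual_pairing_def)
  \<comment> \<open>A nonzero tensor product needs both component products to be nonzero; the map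
    regroups two pairs of factors into one pair of tensors.\<close>
  moreover have "{(s, t). cup_tensor dim_n prd s t u \<noteq> 0}
      \<subseteq> (\<lambda>((p, p'), (q, q')). ((p, q), (p', q'))) ` (?A \<times> ?B)"
    by (force simp: u tensor_form_def)
  ultimately show "finite {(s, t). cup_tensor dim_n prd s t u \<noteq> 0}"
    by (meson finite_surj)
qed

lemma dual_pairing_cup4: "dual_pairing cup4 dual4 top_cell"
proof -
  have top_cell_eq: "top_cell = map_prod (map_prod (map_prod raise1 raise1) raise1) raise1"
    by auto
  show ?thesis
    unfolding cup4_def cup3_def cup2_def dual4_def
    by (simp only: top_cell_eq dual_pairing_cup_tensor dual_pairing_cup1)
qed

section \<open>The star on basis elements and on forms\<close>

lemma basis_form_cup: "basis_form s \<smile> (c *\<^sub>f basis_form t) = c *\<^sub>f cup4 s t"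
proof (rule ext)
  fix u
  let ?A = "{(s, t). cup4 s t u \<noteq> 0}"
  have fin: "finite ?A"
    using dual_pairing_cup4 unfolding dual_pairing_def by blast
  have "(basis_form s \<smile> (c *\<^sub>f basis_form t)) u
      = (\<Sum>z\<in>?A. if z = (s, t) then c * cup4 s t u else 0)"
    unfolding cup_def by (rule sum.cong) (auto simp: basis_form_def split: if_splits)
  \<comment> \<open>If \<open>(s, t)\<close> lies outside \<open>?A\<close>, the sum is 0, and so is
    \<open>cup4 s t u\<close>.\<close>
  also have "\<dots> = c * cup4 s t u"
    using fin by auto
  finally show "(basis_form s \<smile> (c *\<^sub>f basis_form t)) u = (c *\<^sub>f cup4 s t) u"
    by simp
qed

text \<open>Evaluating the defining equation at the top cell leaves \<open>dual4 s\<close> as the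
  only possible target and then fixes the coefficient. The later arguments require only that this
  coefficient is a unit, so its value stays implicit.\<close>

lemma star_basis_eq: "\<exists>c \<in> {1, -1}. star_basis s = c *\<^sub>f basis_form (dual4 s)"
proof -
  obtain c where c: "c \<in> {1, -1}" "cup4 s (dual4 s) = c *\<^sub>f basis_form (top_cell s)"
    using dual_pairing_cup4 unfolding dual_pairing_def by blast
  have l: "lorentz_sign s \<in> {1, -1}"
    by (cases s rule: lorentz_sign.cases) auto
  have cc: "c * c = 1"
    using c(1) by auto
  \<comment> \<open>The cup product with \<open>dual4 s\<close> contributes another factor
    \<open>c\<close>, and \<open>c * c = 1\<close> leaves exactly the Lorentz sign.\<close>
  have "star_basis s = (c * lorentz_sign s) *\<^sub>f basis_form (dual4 s)"
    unfolding star_basis_def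
  proof (rule the_equality)
    have "basis_form s \<smile> (c * lorentz_sign s) *\<^sub>f basis_form (dual4 s)
        = lorentz_sign s *\<^sub>f basis_form (top_cell s)"
      using cc by (auto simp: basis_form_cup c(2))
    moreover have "c * lorentz_sign s \<in> {1, -1}"
      using c(1) l by auto
    ultimately show "(\<exists>c' \<in> {1, -1}. \<exists>t. (c * lorentz_sign s) *\<^sub>f basis_form (dual4 s)
          = c' *\<^sub>f basis_form t) \<and>
        basis_form s \<smile> (c * lorentz_sign s) *\<^sub>f basis_form (dual4 s)
          = lorentz_sign s *\<^sub>f basis_form (top_cell s)"
      by blast
  next
    fix \<eta>
    assume "(\<exists>c \<in> {1, -1}. \<exists>t. \<eta> = c *\<^sub>f basis_form t) \<and>
      basis_form s \<smile> \<eta> = lorentz_sign s *\<^sub>f basis_form (top_cell s)"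
    then obtain a t where \<eta>: "\<eta> = a *\<^sub>f basis_form t"
      and "basis_form s \<smile> (a *\<^sub>f basis_form t) = lorentz_sign s *\<^sub>f basis_form (top_cell s)"
      by blast
    then have "a *\<^sub>f cup4 s t = lorentz_sign s *\<^sub>f basis_form (top_cell s)"
      by (simp add: basis_form_cup)
    \<comment> \<open>The Lorentz sign is nonzero, whereas \<open>cup4 s t\<close> vanishes at the
      top cell unless \<open>t = dual4 s\<close>.\<close>
    then have eq: "a * cup4 s t (top_cell s) = lorentz_sign s"
      by (metis basis_form_def mult.right_neutral scale_apply)
    then have "cup4 s t (top_cell s) \<noteq> 0"
      using l by auto
    then have t: "t = dual4 s"
      using dual_pairing_cup4 unfolding dual_pairing_def by blast
    then have "a * c = lorentz_sign s"
      using eq by (simp add: c(2) basis_form_def)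
    then have "a = c * lorentz_sign s"
      using cc by (metis mult.assoc mult.commute mult.right_neutral)
    then show "\<eta> = (c * lorentz_sign s) *\<^sub>f basis_form (dual4 s)"
      by (simp add: \<eta> t)
  qed
  moreover have "c * lorentz_sign s \<in> {1, -1}"
    using c(1) l by auto
  ultimately show ?thesis by blast
qed

definition star_sign :: "cell4 \<Rightarrow> real"
  where "star_sign s = star_basis s (dual4 s)"

lemma star_sign_square: "star_sign s * star_sign s = 1"
  using star_basis_eq[of s] by (auto simp: star_sign_def basis_form_def)

lemma star_basis_apply: "star_basis s u = (if u = dual4 s then star_sign s else 0)"
  using star_basis_eq[of s] by (auto simp: star_sign_def basis_form_def)

text \<open>By injectivity of \<open>dual4\<close>, the sum defining \<open>star\<close> has the
  single index \<open>s\<close> here.\<close>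

lemma star_apply_dual4: "star \<omega> (dual4 s) = star_sign s * \<omega> s"
proof -
  have "star_sign s \<noteq> 0"
    using star_sign_square[of s] by auto
  then have "{t. star_basis t (dual4 s) \<noteq> 0} = {s}"
    using bij_dual4 by (auto simp: star_basis_apply bij_def inj_eq split: if_splits)
  then show ?thesis
    by (simp add: star_def star_basis_apply)
qed

text \<open>Surjectivity of \<open>dual4\<close> makes the values at dual cells, the ones given by
  \<open>star_apply_dual4\<close>, determine the whole form.\<close>

lemma form_eq_dual4I: "(\<And>s. \<omega> (dual4 s) = \<eta> (dual4 s)) \<Longrightarrow> \<omega> = \<eta>"
proof
  fix u
  assume "\<And>s. \<omega> (dual4 s) = \<eta> (dual4 s)"
  then show "\<omega> u = \<eta> u"
    using bij_pointE[OF bij_dual4, of u] by metis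
qed

lemma star_add: "star (\<omega> + \<eta>) = star \<omega> + star \<eta>"
  by (rule form_eq_dual4I) (simp add: star_apply_dual4 distrib_left)

lemma star_scale: "star (c *\<^sub>f \<omega>) = c *\<^sub>f star \<omega>"
  by (rule form_eq_dual4I) (simp add: star_apply_dual4)

text \<open>\<open>star\<close> permutes cells along \<open>dual4\<close> up to signs of square 1,
  so reading back with the same sign gives a preimage. Injectivity ensures that \<open>inv\<close>
  picks this one.\<close>

lemma inv_star_apply: "inv star \<eta> s = star_sign s * \<eta> (dual4 s)"
proof -
  have "inj star"
  proof (rule injI, rule ext)
    fix \<omega> \<eta> s
    assume "star \<omega> = star \<eta>"
    then have "star_sign s * \<omega> s = star_sign s * \<eta> s"
      by (metis star_apply_dual4)
    then show "\<omega> s = \<eta> s"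
      using star_sign_square[of s] by auto
  qed
  moreover have "star (\<lambda>s. star_sign s * \<eta> (dual4 s)) = \<eta>"
    by (rule form_eq_dual4I)
      (simp add: star_apply_dual4 mult.assoc[symmetric] star_sign_square)
  ultimately have "inv star \<eta> = (\<lambda>s. star_sign s * \<eta> (dual4 s))"
    by (simp add: inv_f_eq)
  then show ?thesis by simp
qed

lemma star_in_forms:
  assumes "\<omega> \<in> forms r"
  shows "star \<omega> \<in> forms (4 - r)"
proof (rule formsI)
  fix u
  assume u: "star \<omega> u \<noteq> 0"
  obtain s where s: "u = dual4 s"
    by (metis bij_pointE[OF bij_dual4])
  have "\<omega> s \<noteq> 0"
    using u by (auto simp: s star_apply_dual4)
  then have "dim4 s = r"
    using assms forms_eq_0 by blast
  then show "dim4 u = 4 - r"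
    using dim4_dual4[of s] by (simp add: s)
qed


section \<open>Codifferential\<close>

lemma codiff_hom_apply:
  "codiff_hom p \<psi> s = (if p = 0 then 0 else (-1) ^ p * star_sign s * d\<^sup>c (star \<psi>) (dual4 s))"
  by (simp add: codiff_hom_def inv_star_apply)

lemma codiff_add: "\<delta>\<^sup>c (\<omega> + \<eta>) = \<delta>\<^sup>c \<omega> + \<delta>\<^sup>c \<eta>"
proof -
  have "codiff_hom p (\<omega> + \<eta>) = codiff_hom p \<omega> + codiff_hom p \<eta>" for p \<omega> \<eta>
    by (rule ext) (simp add: codiff_hom_apply star_add coboundary_add distrib_left)
  then show ?thesis
    by (simp add: codiff_def component_add sum.distrib)
qed

lemma codiff_scale: "\<delta>\<^sup>c (c *\<^sub>f \<omega>) = c *\<^sub>f \<delta>\<^sup>c \<omega>"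
proof -
  have "codiff_hom p (c *\<^sub>f \<omega>) = c *\<^sub>f codiff_hom p \<omega>" for p \<omega>
    by (rule ext) (simp add: codiff_hom_apply star_scale coboundary_scale)
  then show ?thesis
    by (intro ext) (simp add: codiff_def component_scale sum_form_apply sum_distrib_left)
qed

text \<open>The maps star, coboundary and inverse star change the degree from \<open>r\<close> to
  \<open>4 - r\<close>, \<open>5 - r\<close> and \<open>r - 1\<close>. With the equation in this
  form the case \<open>r = 0\<close> states that the codifferential vanishes, without truncated
  subtraction.\<close>

lemma codiff_degree:
  assumes "\<omega> \<in> forms r" and "\<delta>\<^sup>c \<omega> s \<noteq> 0"
  shows "r = dim4 s + 1"
proof -
  obtain p where p: "p \<le> 4" "codiff_hom p (component p \<omega>) s \<noteq> 0"
    using assms(2)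
    by (auto simp: codiff_def sum_form_apply elim: sum.not_neutral_contains_not_neutral)
  then have "p \<noteq> 0" and d: "d\<^sup>c (star (component p \<omega>)) (dual4 s) \<noteq> 0"
    by (auto simp: codiff_hom_apply split: if_splits)
  have "star 0 = 0"
    using star_scale[of 0 0] by simp
  \<comment> \<open>Components of other degrees are 0, and linear maps send them to 0. This also
    bounds \<open>r\<close> by 4, so \<open>4 - r\<close> below is a true difference.\<close>
  then have "p = r"
    using d assms(1) by (auto simp: component_in_forms split: if_splits)
  then have "d\<^sup>c (star \<omega>) (dual4 s) \<noteq> 0"
    using d assms(1) by (simp add: component_in_forms)
  moreover have "d\<^sup>c (star \<omega>) \<in> forms (4 - r + 1)"
    by (intro coboundary_in_forms star_in_forms assms(1))
  ultimately have "dim4 (dual4 s) = 4 - r + 1"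
    using forms_eq_0 by blast
  then show ?thesis
    using dim4_dual4[of s] p(1) \<open>p = r\<close> \<open>p \<noteq> 0\<close> by linarith
qed

theorem theorem5p1:
  fixes m :: real and r :: nat and \<omega>\<^sub>r \<omega>\<^sub>s :: "cell4 form"
  assumes "r \<in> {0, 1, 2, 3}"
    and "\<omega>\<^sub>r \<in> forms r" and "\<omega>\<^sub>s \<in> forms (r + 1)"
    and "(d\<^sup>c - \<delta>\<^sup>c) (\<omega>\<^sub>r + \<omega>\<^sub>s) = m *\<^sub>f (\<omega>\<^sub>r + \<omega>\<^sub>s)"
  shows "\<Delta>\<^sup>c \<omega>\<^sub>r = m\<^sup>2 *\<^sub>f \<omega>\<^sub>r"
proof -
  have eq: "d\<^sup>c \<omega>\<^sub>r s + d\<^sup>c \<omega>\<^sub>s s - \<delta>\<^sup>c \<omega>\<^sub>r s - \<delta>\<^sup>c \<omega>\<^sub>s s = m * (\<omega>\<^sub>r s + \<omega>\<^sub>s s)" for s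
    using fun_cong[OF assms(4), of s] by (simp add: coboundary_add codiff_add)
  \<comment> \<open>The four images live in the degrees \<open>r + 1\<close>, \<open>r + 2\<close>,
    \<open>r - 1\<close> and \<open>r\<close>, which are distinct; hence at each cell at most one of
    them survives in \<open>eq\<close>.\<close>
  have deg: "dim4 s \<noteq> r \<Longrightarrow> \<omega>\<^sub>r s = 0" "dim4 s \<noteq> r + 1 \<Longrightarrow> \<omega>\<^sub>s s = 0"
    "dim4 s \<noteq> r + 1 \<Longrightarrow> d\<^sup>c \<omega>\<^sub>r s = 0" "dim4 s \<noteq> r + 2 \<Longrightarrow> d\<^sup>c \<omega>\<^sub>s s = 0"
    "r \<noteq> dim4 s + 1 \<Longrightarrow> \<delta>\<^sup>c \<omega>\<^sub>r s = 0" "dim4 s \<noteq> r \<Longrightarrow> \<delta>\<^sup>c \<omega>\<^sub>s s = 0" for s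
    using forms_eq_0[OF assms(2)] forms_eq_0[OF assms(3)]
      forms_eq_0[OF coboundary_in_forms[OF assms(2)]]
      forms_eq_0[OF coboundary_in_forms[OF assms(3)]]
      codiff_degree[OF assms(2), of s] codiff_degree[OF assms(3), of s]
    by auto
  have "d\<^sup>c \<omega>\<^sub>r s = m * \<omega>\<^sub>s s" for s
    using eq[of s] deg[of s] by (cases "dim4 s = r + 1") auto
  then have d: "d\<^sup>c \<omega>\<^sub>r = m *\<^sub>f \<omega>\<^sub>s"
    by auto
  \<comment> \<open>In degree \<open>r - 1\<close> the right-hand side of the Duffin equation has no
    component; for \<open>r = 0\<close> no cell meets the condition of the case split.\<close>
  have \<delta>\<^sub>r: "\<delta>\<^sup>c \<omega>\<^sub>r = 0"
  proof
    show "\<delta>\<^sup>c \<omega>\<^sub>r s = 0 s" for s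
      using eq[of s] deg[of s] by (cases "r = dim4 s + 1") auto
  qed
  have \<delta>\<^sub>s: "\<delta>\<^sup>c \<omega>\<^sub>s s = - m * \<omega>\<^sub>r s" for s
    using eq[of s] deg[of s] by (cases "dim4 s = r") auto
  have "\<Delta>\<^sup>c \<omega>\<^sub>r s = (m\<^sup>2 *\<^sub>f \<omega>\<^sub>r) s" for s
    by (simp add: laplacian_def d \<delta>\<^sub>r codiff_scale \<delta>\<^sub>s power2_eq_square)
  then show ?thesis ..
qed

end
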